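(* Suppose that a group $G$ acts by isometries, acylindrically and preserving factors on the product $P=X_1\times\cdots\times X_r$ of hyperbolic spaces $X_1,\ldots,X_r$ ($r\ge 1$), where $P$ has the $\ell_1$ product metric. Then no element of $G$ acts as a parabolic element on $P$.
   Context: A hyperbolic space is a geodesic metric space which is $\delta$-hyperbolic (in the sense of Gromov) for some $\delta\ge 0$; it need not be proper. An isometric action of a group $G$ on a metric space $X$ is acylindrical if for every $\epsilon\ge 0$ there are $N,R$ such that for all $x,y\in X$ with $d(x,y)\ge R$, the set $\{g\in G : d(x,g(x))\le\epsilon \text{ and } d(y,g(y))\le\epsilon\}$ has cardinality at most $N$. An isometric action of $G$ on $P=X_1\times\cdots\times X_r$ (with the $\ell_1$ product metric) preserves factors if the image of $G$ in $\mathrm{Isom}(P)$ lies in $\mathrm{Isom}(X_1)\times\cdots\times\mathrm{Isom}(X_r)$ (acting diagonally), so each $g\in G$ acts as $(g_1,\ldots,g_r)$ with $g_i$ an isometry of $X_i$. An element $g$ acting by isometries on a metric space $X$ is elliptic if $\langle g\rangle$ has bounded orbits; loxodromic if $k\mapsto g^k(x)$ is a quasi-isometric embedding of $\mathbb{Z}$ into $X$ for some (equivalently any) $x\in X$; and parabolic if it is neither elliptic nor loxodromic. *)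

theory Defs
  imports "HOL-Analysis.Analysis" "HOL-Algebra.Group_Action" "HOL-Algebra.Generated_Groups"
begin

subsection \<open>Hyperbolic spaces\<close>

definition geodesic_space :: "'a metric \<Rightarrow> bool" where
  "geodesic_space X \<longleftrightarrow>
     (\<forall>x\<in>mspace X. \<forall>y\<in>mspace X. \<exists>c :: real \<Rightarrow> 'a.
        c \<in> {0..mdist X x y} \<rightarrow> mspace X \<and> c 0 = x \<and> c (mdist X x y) = y \<and>
        (\<forall>s\<in>{0..mdist X x y}. \<forall>t\<in>{0..mdist X x y}. mdist X (c s) (c t) = \<bar>s - t\<bar>))"

definition Gromov_product :: "'a metric \<Rightarrow> 'a \<Rightarrow> 'a \<Rightarrow> 'a \<Rightarrow> real" where
  "Gromov_product X w x y = (mdist X w x + mdist X w y - mdist X x y) / 2"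

definition delta_hyperbolic :: "real \<Rightarrow> 'a metric \<Rightarrow> bool" where
  "delta_hyperbolic \<delta> X \<longleftrightarrow>
     (\<forall>w\<in>mspace X. \<forall>x\<in>mspace X. \<forall>y\<in>mspace X. \<forall>z\<in>mspace X.
        Gromov_product X w x z \<ge> min (Gromov_product X w x y) (Gromov_product X w y z) - \<delta>)"

definition hyperbolic_space :: "'a metric \<Rightarrow> bool" where
  "hyperbolic_space X \<longleftrightarrow> geodesic_space X \<and> (\<exists>\<delta>\<ge>0. delta_hyperbolic \<delta> X)"


subsection \<open>The \<open>\<ell>\<^sub>1\<close> product\<close>

definition l1_product :: "nat \<Rightarrow> (nat \<Rightarrow> 'a metric) \<Rightarrow> (nat \<Rightarrow> 'a) metric" where
  "l1_product r X =
     metric (\<Pi>\<^sub>E i\<in>{1..r}. mspace (X i), \<lambda>x y. \<Sum>i=1..r. mdist (X i) (x i) (y i))"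

text \<open>The arguments of \<^const>\<open>metric\<close> above do form a metric space, so that
  \<^const>\<open>mspace\<close> and \<^const>\<open>mdist\<close> return them.\<close>

lemma Metric_space_l1_product:
  fixes X :: "nat \<Rightarrow> 'a metric"
  shows "Metric_space (\<Pi>\<^sub>E i\<in>{1..r}. mspace (X i)) (\<lambda>x y. \<Sum>i=1..r. mdist (X i) (x i) (y i))"
proof
  fix x y z :: "nat \<Rightarrow> 'a"
  show "0 \<le> (\<Sum>i=1..r. mdist (X i) (x i) (y i))"
    by (simp add: sum_nonneg)
  show "(\<Sum>i=1..r. mdist (X i) (x i) (y i)) = (\<Sum>i=1..r. mdist (X i) (y i) (x i))"
    by (simp add: mdist_commute)
  assume x: "x \<in> (\<Pi>\<^sub>E i\<in>{1..r}. mspace (X i))" and y: "y \<in> (\<Pi>\<^sub>E i\<in>{1..r}. mspace (X i))"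
  have "(\<Sum>i=1..r. mdist (X i) (x i) (y i)) = 0 \<longleftrightarrow> (\<forall>i\<in>{1..r}. x i = y i)"
  proof -
    have "x i \<in> mspace (X i)" "y i \<in> mspace (X i)" if "i \<in> {1..r}" for i
      using x y that by (auto simp: PiE_iff)
    then show ?thesis
      by (subst sum_nonneg_eq_0_iff) auto
  qed
  also have "\<dots> \<longleftrightarrow> x = y"
    using x y by (auto intro: PiE_ext)
  finally show "(\<Sum>i=1..r. mdist (X i) (x i) (y i)) = 0 \<longleftrightarrow> x = y" .
  assume z: "z \<in> (\<Pi>\<^sub>E i\<in>{1..r}. mspace (X i))"
  show "(\<Sum>i=1..r. mdist (X i) (x i) (z i))
          \<le> (\<Sum>i=1..r. mdist (X i) (x i) (y i)) + (\<Sum>i=1..r. mdist (X i) (y i) (z i))"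
    unfolding sum.distrib [symmetric]
    using x y z by (intro sum_mono mdist_triangle) (auto simp: PiE_iff)
qed

lemma mspace_l1_product [simp]: "mspace (l1_product r X) = (\<Pi>\<^sub>E i\<in>{1..r}. mspace (X i))"
  unfolding l1_product_def by (rule Metric_space.mspace_metric [OF Metric_space_l1_product])

lemma mdist_l1_product [simp]:
  "mdist (l1_product r X) = (\<lambda>x y. \<Sum>i=1..r. mdist (X i) (x i) (y i))"
  unfolding l1_product_def by (rule Metric_space.mdist_metric [OF Metric_space_l1_product])


subsection \<open>Isometric actions\<close>

definition isometries :: "'a metric \<Rightarrow> ('a \<Rightarrow> 'a) set" where
  "isometries X =
     {f. bij_betw f (mspace X) (mspace X) \<and>
         (\<forall>x\<in>mspace X. \<forall>y\<in>mspace X. mdist X (f x) (f y) = mdist X x y)}"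

definition isometric_action ::
    "('g, 'm) monoid_scheme \<Rightarrow> 'a metric \<Rightarrow> ('g \<Rightarrow> 'a \<Rightarrow> 'a) \<Rightarrow> bool" where
  "isometric_action G X \<phi> \<longleftrightarrow>
     group_action G (mspace X) \<phi> \<and> (\<forall>g\<in>carrier G. \<phi> g \<in> isometries X)"

definition acylindrical ::
    "('g, 'm) monoid_scheme \<Rightarrow> 'a metric \<Rightarrow> ('g \<Rightarrow> 'a \<Rightarrow> 'a) \<Rightarrow> bool" where
  "acylindrical G X \<phi> \<longleftrightarrow>
     (\<forall>\<epsilon>::real. \<epsilon> \<ge> 0 \<longrightarrow> (\<exists>(N::nat) (R::real). \<forall>x\<in>mspace X. \<forall>y\<in>mspace X. mdist X x y \<ge> R \<longrightarrow>
        finite {g \<in> carrier G. mdist X x (\<phi> g x) \<le> \<epsilon> \<and> mdist X y (\<phi> g y) \<le> \<epsilon>} \<and>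
        card {g \<in> carrier G. mdist X x (\<phi> g x) \<le> \<epsilon> \<and> mdist X y (\<phi> g y) \<le> \<epsilon>} \<le> N))"

definition preserves_factors ::
    "('g, 'm) monoid_scheme \<Rightarrow> nat \<Rightarrow> (nat \<Rightarrow> 'a metric) \<Rightarrow>
     ('g \<Rightarrow> (nat \<Rightarrow> 'a) \<Rightarrow> (nat \<Rightarrow> 'a)) \<Rightarrow> bool" where
  "preserves_factors G r X \<phi> \<longleftrightarrow>
     (\<forall>g\<in>carrier G. \<exists>h. (\<forall>i\<in>{1..r}. h i \<in> isometries (X i)) \<and>
        (\<forall>x\<in>mspace (l1_product r X). \<phi> g x = (\<lambda>i\<in>{1..r}. h i (x i))))"


subsection \<open>Types of isometries\<close>

definition quasi_isometric_embedding :: "'a metric \<Rightarrow> 'b metric \<Rightarrow> ('a \<Rightarrow> 'b) \<Rightarrow> bool" where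
  "quasi_isometric_embedding X Y f \<longleftrightarrow>
     f \<in> mspace X \<rightarrow> mspace Y \<and>
     (\<exists>L\<ge>1. \<exists>C\<ge>0. \<forall>x\<in>mspace X. \<forall>y\<in>mspace X.
        mdist X x y / L - C \<le> mdist Y (f x) (f y) \<and>
        mdist Y (f x) (f y) \<le> L * mdist X x y + C)"

definition int_metric :: "int metric" where
  "int_metric = metric (UNIV, \<lambda>m n. real_of_int \<bar>m - n\<bar>)"

lemma Metric_space_int: "Metric_space (UNIV :: int set) (\<lambda>m n. real_of_int \<bar>m - n\<bar>)"
  by unfold_locales auto

lemma mspace_int_metric [simp]: "mspace int_metric = UNIV"
  unfolding int_metric_def by (rule Metric_space.mspace_metric [OF Metric_space_int])

lemma mdist_int_metric [simp]: "mdist int_metric = (\<lambda>m n. real_of_int \<bar>m - n\<bar>)"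
  unfolding int_metric_def by (rule Metric_space.mdist_metric [OF Metric_space_int])

definition elliptic ::
    "('g, 'm) monoid_scheme \<Rightarrow> 'a metric \<Rightarrow> ('g \<Rightarrow> 'a \<Rightarrow> 'a) \<Rightarrow> 'g \<Rightarrow> bool" where
  "elliptic G X \<phi> g \<longleftrightarrow>
     (\<forall>x\<in>mspace X.
        Metric_space.mbounded (mspace X) (mdist X) {\<phi> h x | h. h \<in> generate G {g}})"

definition loxodromic ::
    "('g, 'm) monoid_scheme \<Rightarrow> 'a metric \<Rightarrow> ('g \<Rightarrow> 'a \<Rightarrow> 'a) \<Rightarrow> 'g \<Rightarrow> bool" where
  "loxodromic G X \<phi> g \<longleftrightarrow>
     (\<exists>x\<in>mspace X.
        quasi_isometric_embedding int_metric X
          (\<lambda>k. \<phi> (g [^]\<^bsub>G\<^esub> k) x))"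

definition parabolic ::
    "('g, 'm) monoid_scheme \<Rightarrow> 'a metric \<Rightarrow> ('g \<Rightarrow> 'a \<Rightarrow> 'a) \<Rightarrow> 'g \<Rightarrow> bool" where
  "parabolic G X \<phi> g \<longleftrightarrow> \<not> elliptic G X \<phi> g \<and> \<not> loxodromic G X \<phi> g"

end

theory Submission
  imports Defs
begin

text \<open>
  Let \<open>g\<close> be parabolic on the product. No factor \<open>g\<^sub>i\<close> is loxodromic, and some \<open>g\<^sub>i\<close> has unbounded
  orbits. For such a factor take a very long geodesic from a point \<open>o\<close> to \<open>g\<^sub>i\<^sup>m o\<close>. For \<open>k \<le> N\<close> both of
  its ends are moved by \<open>g\<^sub>i\<^sup>k\<close> by a bounded amount, so \<open>g\<^sub>i\<^sup>k\<close> acts on its middle part, up to a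
  multiple of \<open>\<delta>\<close>, as a translation along the geodesic. A translation length that is large compared to
  \<open>\<delta>\<close> would make \<open>g\<^sub>i\<^sup>k\<close>, and hence \<open>g\<^sub>i\<close>, loxodromic. So all \<open>g\<^sub>i\<^sup>k\<close> with \<open>k \<le> N\<close> move two points far apart
  from each other by at most \<open>16 * \<delta>\<close>. In the factors with bounded orbits any point will do. As \<open>N\<close> is
  arbitrary and \<open>g\<close> has infinite order, this contradicts acylindricity.
\<close>

section \<open>Isometries of hyperbolic spaces\<close>

lemma isometries_in: "f \<in> isometries X \<Longrightarrow> x \<in> mspace X \<Longrightarrow> f x \<in> mspace X"
  by (auto simp: isometries_def bij_betw_def)

lemma isometries_mdist:
  "f \<in> isometries X \<Longrightarrow> x \<in> mspace X \<Longrightarrow> y \<in> mspace X \<Longrightarrow> mdist X (f x) (f y) = mdist X x y"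
  by (auto simp: isometries_def)

lemma mdist_self [simp]: "x \<in> mspace X \<Longrightarrow> mdist X x x = 0"
  by simp

lemma isometries_funpow:
  assumes "f \<in> isometries X"
  shows "f ^^ n \<in> isometries X"
proof -
  have "bij_betw (f ^^ n) (mspace X) (mspace X)"
    using assms by (intro bij_betw_funpow) (auto simp: isometries_def)
  moreover have "mdist X ((f ^^ n) x) ((f ^^ n) y) = mdist X x y"
    if "x \<in> mspace X" "y \<in> mspace X" for x y
    using assms that
    by (induction n arbitrary: x y) (auto simp: funpow_Suc_right isometries_mdist isometries_in
      simp del: funpow.simps)
  ultimately show ?thesis by (auto simp: isometries_def)
qed

lemma mdist_funpow_add:
  assumes "f \<in> isometries X" "x \<in> mspace X"
  shows "mdist X ((f ^^ m) x) ((f ^^ (m + n)) x) = mdist X x ((f ^^ n) x)"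
  using isometries_mdist[OF isometries_funpow[OF assms(1)], of x "(f ^^ n) x" m] assms
  by (simp add: funpow_add isometries_in isometries_funpow)

lemma mdist_funpow_le:
  assumes "f \<in> isometries X" "x \<in> mspace X"
  shows "mdist X x ((f ^^ n) x) \<le> n * mdist X x (f x)"
proof (induction n)
  case 0
  then show ?case using assms by simp
next
  case (Suc n)
  have "mdist X x ((f ^^ Suc n) x) \<le> mdist X x ((f ^^ n) x) + mdist X ((f ^^ n) x) ((f ^^ Suc n) x)"
    using assms isometries_in[OF isometries_funpow[OF assms(1)] assms(2)]
    by (intro mdist_triangle)
  also have "mdist X ((f ^^ n) x) ((f ^^ Suc n) x) = mdist X x (f x)"
    using mdist_funpow_add[OF assms, of n 1] by simp
  finally show ?case using Suc by (simp add: algebra_simps)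
qed

section \<open>The four-point inequality and displacement estimates\<close>

text \<open>Doubling the Gromov product inequality based at \<open>w\<close> cancels the surplus
  distances to \<open>w\<close>. The result is symmetric in the three ways of pairing four points,
  the form used below.\<close>

lemma hyperbolic_four_point:
  assumes "delta_hyperbolic \<delta> X" "x \<in> mspace X" "y \<in> mspace X" "z \<in> mspace X" "w \<in> mspace X"
  shows "mdist X x y + mdist X z w
    \<le> max (mdist X x z + mdist X y w) (mdist X x w + mdist X y z) + 2 * \<delta>"
proof -
  have "Gromov_product X w x y \<ge> min (Gromov_product X w x z) (Gromov_product X w z y) - \<delta>"
    using assms by (auto simp: delta_hyperbolic_def)
  then show ?thesis
    unfolding Gromov_product_def
    by (simp add: mdist_commute[of X w] mdist_commute[of X z y] min_def max_def field_simps
        split: if_splits)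
qed

text \<open>Coornaert, Delzant and Papadopoulos' criterion for an isometry to be loxodromic.\<close>

lemma linear_displacement:
  assumes hyp: "delta_hyperbolic \<delta> X" and f: "f \<in> isometries X" and x: "x \<in> mspace X"
    and le: "mdist X x (f x) + 2 * \<delta> + \<eta> \<le> mdist X x (f (f x))" and "\<eta> > 0" "\<delta> \<ge> 0"
  shows "n * \<eta> \<le> mdist X x ((f ^^ n) x)"
proof -
  define a where "a n = mdist X x ((f ^^ n) x)" for n
  have a2: "a 1 + 2 * \<delta> + \<eta> \<le> a 2"
    using le by (simp add: a_def numeral_2_eq_2)
  have in_X: "(f ^^ n) x \<in> mspace X" for n
    by (rule isometries_in[OF isometries_funpow[OF f] x])
  have shift: "mdist X ((f ^^ m) x) ((f ^^ k) x) = a (k - m)" if "m \<le> k" for m k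
    using mdist_funpow_add[OF f x, of m "k - m"] that by (simp add: a_def)
  have "a 2 \<le> 2 * a 1"
    using mdist_funpow_le[OF f x, of 2] by (simp add: a_def)
  then have base: "a 0 + \<eta> \<le> a 1"
    using a2 x \<open>\<delta> \<ge> 0\<close> by (simp add: a_def)
  have step: "a n + \<eta> \<le> a (Suc n)" for n
  proof (induction n)
    case 0
    then show ?case using base by simp
  next
    case (Suc n)
    \<comment> \<open>The points are \<open>x\<close>, \<open>f x\<close>, \<open>f (f x)\<close>
      and the iterate of index \<open>n + 2\<close>. If the first term of the maximum won,
      \<open>a (Suc n) \<le> a n - \<eta>\<close> would follow, against the induction hypothesis;
      the second term gives the claim.\<close>
    have "a 2 + a (Suc n) \<le> max (a 1 + a n) (a (Suc (Suc n)) + a 1) + 2 * \<delta>"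
    proof -
      have "mdist X x ((f ^^ m) x) = a m" for m by (simp add: a_def)
      moreover have "mdist X ((f ^^ 1) x) ((f ^^ Suc (Suc n)) x) = a (Suc n)"
        "mdist X ((f ^^ 2) x) ((f ^^ Suc (Suc n)) x) = a n"
        "mdist X ((f ^^ 2) x) ((f ^^ 1) x) = a 1"
        using shift[of 1 "Suc (Suc n)"] shift[of 2 "Suc (Suc n)"] shift[of 1 2]
        by (simp_all add: numeral_2_eq_2 mdist_commute[of X "f (f x)" "f x"])
      ultimately show ?thesis
        using hyperbolic_four_point[OF hyp x in_X[of 2] in_X[of 1] in_X[of "Suc (Suc n)"]]
        by presburger
    qed
    then show ?case using Suc a2 \<open>\<eta> > 0\<close> by (simp add: max_def split: if_splits)
  qed
  have "n * \<eta> \<le> a n"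
  proof (induction n)
    case 0
    then show ?case by (simp add: a_def)
  next
    case (Suc n)
    then show ?case using step[of n] by (simp add: algebra_simps)
  qed
  then show ?thesis by (simp add: a_def)
qed

text \<open>Pair \<open>x\<close> with \<open>y\<close> and \<open>a\<close> with \<open>b\<close>
  in the four-point inequality; the excess \<open>e\<close> lets the distances to \<open>b\<close>
  be traded for distances to \<open>a\<close>.\<close>

lemma mdist_near_geodesic:
  assumes "delta_hyperbolic \<delta> X" "a \<in> mspace X" "b \<in> mspace X" "x \<in> mspace X" "y \<in> mspace X"
    and "mdist X a x + mdist X x b \<le> mdist X a b + e"
    and "mdist X a y + mdist X y b \<le> mdist X a b + e"
  shows "mdist X x y \<le> \<bar>mdist X a x - mdist X a y\<bar> + e + 2 * \<delta>"
proof -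
  have "mdist X x y + mdist X a b
      \<le> max (mdist X a x + mdist X y b) (mdist X x b + mdist X a y) + 2 * \<delta>"
    using hyperbolic_four_point[OF assms(1,4,5,2,3)]
    by (simp only: mdist_commute[of X x a] mdist_commute[of X y a])
  then show ?thesis
    using assms(6,7) by argo
qed

text \<open>Along the geodesic \<open>h\<close> shifts \<open>p\<close> by some \<open>u\<close> and
  \<open>h\<close> twice by \<open>2 * u\<close>, up to multiples of \<open>\<delta>\<close>.
  Together with \<open>h2\<close> this gives
  \<open>2 * \<bar>u\<bar> \<le> \<bar>u\<bar> + 10 * \<delta>\<close>, and \<open>h p\<close> is
  within \<open>\<bar>u\<bar> + 6 * \<delta>\<close> of \<open>p\<close>; hence the constant
  16.\<close>

lemma isometry_small_displacement:
  assumes hyp: "delta_hyperbolic \<delta> X" and \<delta>: "\<delta> \<ge> 0" and h: "h \<in> isometries X"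
    and a: "a \<in> mspace X" and b: "b \<in> mspace X" and p: "p \<in> mspace X"
    and geo: "mdist X a p + mdist X p b = mdist X a b"
    and ha: "mdist X a (h a) \<le> K" and hb: "mdist X b (h b) \<le> K"
    and far_a: "mdist X a p > 2 * K + 3 * \<delta>" and far_b: "mdist X p b > 2 * K + 3 * \<delta>"
    and h2: "mdist X p (h (h p)) \<le> mdist X p (h p) + 2 * \<delta>"
  shows "mdist X p (h p) \<le> 16 * \<delta>"
proof -
  let ?d = "mdist X"
  note [simp] = isometries_in[OF h] a b p
  have sym: "?d x y = ?d y x" for x y by (rule mdist_commute)
  have K: "K \<ge> 0" using ha mdist_nonneg[of X a "h a"] by linarith
  have "h ` mspace X = mspace X" using h by (simp add: isometries_def bij_betw_def)
  then have "a \<in> h ` mspace X" using a by simp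
  then obtain c where c: "c \<in> mspace X" "h c = a" by blast
  note [simp] = c(1)
  have iso: "?d (h x) (h y) = ?d x y" if "x \<in> mspace X" "y \<in> mspace X" for x y
    using isometries_mdist[OF h that] .
  have ca: "?d a c \<le> K" using iso[of c a] ha c a sym[of a c] sym[of a "h a"] by simp
  \<comment> \<open>The signed shift of \<open>p\<close> along the geodesic, measured by the
    distance to \<open>a\<close>.\<close>
  define u where "u = ?d a (h p) - ?d a p"
  \<comment> \<open>Seen from \<open>h p\<close>, the product of \<open>h a\<close> and
    \<open>h b\<close> vanishes, while \<open>h a\<close>, \<open>a\<close> and likewise
    \<open>b\<close>, \<open>h b\<close> have large products, being close together and far away. Two
    uses of hyperbolicity bound the product of \<open>a\<close> and \<open>b\<close> by
    \<open>2 * \<delta>\<close>; the excess is twice that.\<close>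
  have "?d a (h p) + ?d (h p) b \<le> ?d a b + 4 * \<delta>"
  proof -
    define G where "G x y = Gromov_product X (h p) x y" for x y
    have G3: "G x z \<ge> min (G x y) (G y z) - \<delta>"
      if "x \<in> mspace X" "y \<in> mspace X" "z \<in> mspace X" for x y z
      using hyp that unfolding G_def by (auto simp: delta_hyperbolic_def)
    have "G (h a) (h b) = 0"
      using geo iso[of p a] iso[of p b] iso[of a b] sym[of a p] by (simp add: G_def Gromov_product_def)
    moreover have "G (h a) a > 2 * \<delta>"
      using mdist_triangle[of "h p" X a "h a"] iso[of p a] ha far_a K \<delta> sym[of p a] sym[of a "h a"]
      by (simp add: G_def Gromov_product_def)
    moreover have "G b (h b) > 2 * \<delta>"
      using mdist_triangle[of "h p" X b "h b"] iso[of p b] hb far_b K \<delta>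
      by (simp add: G_def Gromov_product_def)
    ultimately have "G a b \<le> 2 * \<delta>"
      using G3[of "h a" a "h b"] G3[of a b "h b"] \<delta>
      by (simp add: min_def split: if_splits)
    then show ?thesis using sym[of a "h p"] by (simp add: G_def Gromov_product_def)
  qed
  then have near: "?d p (h p) \<le> \<bar>u\<bar> + 6 * \<delta>"
    using mdist_near_geodesic[OF hyp, of a b p "h p" "4 * \<delta>"] geo \<delta> by (simp add: u_def)
  have u: "\<bar>u\<bar> \<le> K"
    using mdist_triangle[of a X "h a" "h p"] mdist_triangle[of "h a" X a "h p"] iso[of a p] ha
      sym[of a "h a"]
    by (simp add: u_def)
  text \<open>With \<open>c\<close> the preimage of \<open>a\<close>, the shifts of \<open>p\<close> and \<open>h p\<close> under \<open>h\<close> along the geodesic are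
    differences of distances to \<open>c\<close> and \<open>a\<close>, which are almost constant far away from \<open>a\<close>.\<close>
  have e1: "?d c p = ?d a (h p)" "?d c (h p) = ?d a (h (h p))"
    using iso[of c p] iso[of c "h p"] c by simp_all
  have "\<bar>(?d c (h p) + ?d a p) - (?d a (h p) + ?d c p)\<bar> \<le> 2 * \<delta>"
  proof -
    \<comment> \<open>Of the three pairings of \<open>a\<close>, \<open>c\<close>, \<open>p\<close>,
      \<open>h p\<close>, this one has the strictly smallest sum because \<open>p\<close> is further
      than \<open>2 * K + 3 * \<delta>\<close> from \<open>a\<close>. The two larger sums then
      differ by at most \<open>2 * \<delta>\<close>.\<close>
    have s: "?d p (h p) + ?d a c \<le> 2 * K + 6 * \<delta>" using near u ca by simp
    have s1: "?d c (h p) + ?d a p \<ge> 2 * ?d a p - 2 * K"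
      using mdist_triangle[of a X c "h p"] ca u unfolding u_def by simp
    have s2: "?d a (h p) + ?d c p \<ge> 2 * ?d a p - 2 * K"
      using e1 u unfolding u_def by simp
    show ?thesis
      using hyperbolic_four_point[OF hyp, of c "h p" a p]
        hyperbolic_four_point[OF hyp, of a "h p" c p] s s1 s2 far_a
        sym[of "h p" p] sym[of "h p" a] sym[of "h p" c] sym[of c a] by simp
  qed
  then have "\<bar>?d a (h (h p)) - ?d a p - 2 * u\<bar> \<le> 2 * \<delta>"
    by (simp add: e1 u_def)
  moreover have "\<bar>?d a (h (h p)) - ?d a p\<bar> \<le> ?d p (h (h p))"
    using mdist_triangle[of a X p "h (h p)"] mdist_triangle[of a X "h (h p)" p] sym[of p "h (h p)"]
    by simp
  ultimately show ?thesis using h2 near by linarith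
qed

text \<open>Write \<open>n\<close> as a multiple of \<open>k\<close> plus a remainder; the remainder
  changes the displacement by a bounded amount. Thus linear growth for a power of \<open>f\<close>
  passes to \<open>f\<close>.\<close>

lemma linear_displacement_root:
  assumes f: "f \<in> isometries X" and p: "p \<in> mspace X" and "k > 0" "\<eta> > 0"
    and le: "\<And>n. real n * \<eta> \<le> mdist X p (((f ^^ k) ^^ n) p)"
  shows "\<exists>c>0. \<exists>C. \<forall>n. c * real n - C \<le> mdist X p ((f ^^ n) p)"
proof (intro exI conjI allI)
  show "\<eta> / k > 0" using assms by simp
  fix n
  let ?q = "n div k" and ?s = "n mod k"
  have inX: "(f ^^ m) p \<in> mspace X" for m
    by (rule isometries_in[OF isometries_funpow[OF f] p])
  have "mdist X p ((f ^^ (k * ?q)) p) \<le> mdist X p ((f ^^ n) p) + mdist X ((f ^^ (k * ?q)) p) ((f ^^ n) p)"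
    using mdist_triangle[of p X "(f ^^ n) p" "(f ^^ (k * ?q)) p"] inX p
    by (simp add: mdist_commute[of X "(f ^^ n) p" "(f ^^ (k * ?q)) p"])
  also have "mdist X ((f ^^ (k * ?q)) p) ((f ^^ n) p) = mdist X p ((f ^^ ?s) p)"
    using mdist_funpow_add[OF f p, of "k * ?q" ?s] by simp
  also have "\<dots> \<le> ?s * mdist X p (f p)" by (rule mdist_funpow_le[OF f p])
  also have "\<dots> \<le> k * mdist X p (f p)"
    using \<open>k > 0\<close> by (intro mult_right_mono) auto
  finally have 1: "?q * \<eta> \<le> mdist X p ((f ^^ n) p) + k * mdist X p (f p)"
    using le[of ?q] by (simp add: funpow_mult mult.commute)
  have "n \<le> k * (?q + 1)"
    using \<open>k > 0\<close> dividend_less_times_div[of k n] by (simp add: algebra_simps)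
  then have "real n \<le> real (k * (?q + 1))" by (rule of_nat_mono)
  then have "real n / k \<le> ?q + 1"
    using \<open>k > 0\<close> by (simp add: field_simps)
  then have "real n / k * \<eta> \<le> (?q + 1) * \<eta>"
    using \<open>\<eta> > 0\<close> by (intro mult_right_mono) auto
  \<comment> \<open>In the additive constant, \<open>\<eta>\<close> pays for rounding
    \<open>n / k\<close> down and the other term for the remainder.\<close>
  then show "\<eta> / k * real n - (\<eta> + k * mdist X p (f p)) \<le> mdist X p ((f ^^ n) p)"
    using 1 by (simp add: algebra_simps)
qed

text \<open>The bound \<open>16 * \<delta>\<close> is independent of \<open>R\<close> and
  \<open>N\<close>, so the \<open>\<epsilon>\<close> of acylindricity can be fixed before them. The
  points are taken in the middle of a geodesic from \<open>x\<close> to a remote iterate of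
  \<open>x\<close>.\<close>

lemma parabolic_isometry_small_displacement:
  assumes geo: "geodesic_space X" and hyp: "delta_hyperbolic \<delta> X" and \<delta>: "\<delta> \<ge> 0"
    and f: "f \<in> isometries X" and x: "x \<in> mspace X"
    and unbounded: "\<And>B. \<exists>n. mdist X x ((f ^^ n) x) > B"
    and not_lox: "\<And>p c C. p \<in> mspace X \<Longrightarrow> c > 0 \<Longrightarrow> \<exists>n. mdist X p ((f ^^ n) p) < c * real n - C"
  obtains p q where "p \<in> mspace X" "q \<in> mspace X" "mdist X p q \<ge> R"
    "\<And>k. k \<le> N \<Longrightarrow> mdist X p ((f ^^ k) p) \<le> 16 * \<delta>"
    "\<And>k. k \<le> N \<Longrightarrow> mdist X q ((f ^^ k) q) \<le> 16 * \<delta>"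
proof -
  define K where "K = N * mdist X x (f x)"
  \<comment> \<open>Points at distance at least \<open>T\<close> from both ends meet the strict
    inequalities \<open>far_a\<close> and \<open>far_b\<close>. Taking \<open>S \<ge> 0\<close>
    keeps the parameter \<open>T + S\<close> in the middle part.\<close>
  define T where "T = 2 * K + 3 * \<delta> + 1"
  define S where "S = max R 0"
  have K: "K \<ge> 0" by (simp add: K_def)
  then have T: "T > 0" using \<delta> by (simp add: T_def)
  obtain m where m: "mdist X x ((f ^^ m) x) > S + 2 * T" using unbounded by blast
  define y where "y = (f ^^ m) x"
  have y: "y \<in> mspace X" unfolding y_def by (rule isometries_in[OF isometries_funpow[OF f] x])
  define D where "D = mdist X x y"
  have D: "D > S + 2 * T" using m by (simp add: D_def y_def)
  obtain c where c: "c \<in> {0..D} \<rightarrow> mspace X" "c 0 = x" "c D = y"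
    and dc: "\<And>s t. s \<in> {0..D} \<Longrightarrow> t \<in> {0..D} \<Longrightarrow> mdist X (c s) (c t) = \<bar>s - t\<bar>"
    using geo x y unfolding geodesic_space_def D_def by blast
  \<comment> \<open>Iterates of \<open>f\<close> commute, so \<open>y\<close> is moved exactly as
    far as \<open>x\<close>.\<close>
  have near: "mdist X z ((f ^^ n) z) \<le> K" if "n \<le> N" "z = x \<or> z = y" for n z
  proof -
    have "mdist X z ((f ^^ n) z) = mdist X x ((f ^^ n) x)"
      using that isometries_mdist[OF isometries_funpow[OF f] x, of "(f ^^ n) x" m]
        isometries_in[OF isometries_funpow[OF f] x]
      by (auto simp: y_def funpow_add[symmetric, THEN fun_cong, simplified] add.commute)
    also have "\<dots> \<le> n * mdist X x (f x)" by (rule mdist_funpow_le[OF f x])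
    also have "\<dots> \<le> K" unfolding K_def using that by (intro mult_right_mono) auto
    finally show ?thesis .
  qed
  have small: "mdist X (c t) ((f ^^ k) (c t)) \<le> 16 * \<delta>" if t: "T \<le> t" "t \<le> D - T" and k: "k \<le> N" for t k
  proof (cases "k = 0")
    case True
    have "c t \<in> mspace X" using c t T by auto
    then show ?thesis using True \<delta> by simp
  next
    case False
    have ct: "c t \<in> mspace X" using c t T by auto
    let ?h = "f ^^ k"
    \<comment> \<open>Otherwise the displacement of \<open>?h\<close> at \<open>c t\<close> grows
      linearly, and so does that of \<open>f\<close>, against \<open>not_lox\<close>.\<close>
    have "mdist X (c t) (?h (?h (c t))) \<le> mdist X (c t) (?h (c t)) + 2 * \<delta>"
    proof (rule ccontr)
      assume A: "\<not> ?thesis"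
      define \<eta> where "\<eta> = mdist X (c t) (?h (?h (c t))) - (mdist X (c t) (?h (c t)) + 2 * \<delta>)"
      have "\<eta> > 0" using A by (simp add: \<eta>_def)
      then have "real n * \<eta> \<le> mdist X (c t) ((?h ^^ n) (c t))" for n
        using linear_displacement[OF hyp isometries_funpow[OF f] ct, of k \<eta> n] \<delta>
        by (simp add: \<eta>_def)
      then obtain e C where "e > 0" "\<And>n. e * real n - C \<le> mdist X (c t) ((f ^^ n) (c t))"
        using linear_displacement_root[OF f ct, of k \<eta>] False \<open>\<eta> > 0\<close> by blast
      then show False using not_lox[OF ct, of e C] by (meson not_le)
    qed
    moreover have "mdist X x (c t) = t" "mdist X (c t) y = D - t"
      using dc[of 0 t] dc[of t D] c t T D by auto
    ultimately show ?thesis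
      using isometry_small_displacement[OF hyp \<delta> isometries_funpow[OF f] x y ct, of k K] near[OF k] t
      by (auto simp: D_def T_def)
  qed
  show ?thesis
  proof (rule that)
    show "c T \<in> mspace X" "c (T + S) \<in> mspace X" using c D T S_def by auto
    show "mdist X (c T) (c (T + S)) \<ge> R" using dc[of T "T + S"] D T S_def by auto
  qed (use small D S_def in auto)
qed

section \<open>Acylindrical actions on products\<close>

lemma action_nat_pow_l1_product:
  fixes G (structure) and X :: "nat \<Rightarrow> 'a metric"
  assumes act: "group_action G (mspace (l1_product r X)) \<phi>" and g: "g \<in> carrier G"
    and h: "\<And>i. i \<in> {1..r} \<Longrightarrow> h i \<in> isometries (X i)"
    and \<phi>: "\<And>x. x \<in> mspace (l1_product r X) \<Longrightarrow> \<phi> g x = (\<lambda>i\<in>{1..r}. h i (x i))"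
    and x: "x \<in> mspace (l1_product r X)"
  shows "\<phi> (g [^] (n::nat)) x = (\<lambda>i\<in>{1..r}. (h i ^^ n) (x i))"
proof -
  interpret group_action G "mspace (l1_product r X)" \<phi> by fact
  interpret group G by (rule group_hom.axioms(1)[OF group_hom])
  show ?thesis
    using x
  proof (induction n arbitrary: x)
    case 0
    \<comment> \<open>Extensionality makes the restriction of \<open>x\<close> to the index set
      equal to \<open>x\<close>.\<close>
    then have "x \<in> extensional {1..r}" by (simp add: PiE_def)
    then show ?case using 0 by (auto simp: extensional_restrict simp flip: id_eq_one)
  next
    case (Suc n)
    have "\<phi> (g [^] Suc n) x = \<phi> (g [^] n) (\<phi> g x)"
      using composition_rule[OF Suc.prems] g by simp
    also have "\<dots> = (\<lambda>i\<in>{1..r}. (h i ^^ n) ((\<phi> g x) i))"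
      using Suc.IH element_image[OF g Suc.prems] by blast
    finally show ?case
      using \<phi>[OF Suc.prems] by (auto simp: funpow_Suc_right simp del: funpow.simps)
  qed
qed

text \<open>Cancel the isometry given by the power with smaller exponent. This reduces both types of
  isometry, which concern integer powers, to natural powers.\<close>

lemma isometric_action_mdist_int_pow:
  fixes G (structure) and m k :: int
  assumes act: "isometric_action G X \<phi>" and g: "g \<in> carrier G" and x: "x \<in> mspace X"
  shows "mdist X (\<phi> (g [^] m) x) (\<phi> (g [^] k) x) = mdist X x (\<phi> (g [^] nat \<bar>m - k\<bar>) x)"
proof -
  interpret group_action G "mspace X" \<phi> using act by (simp add: isometric_action_def)
  interpret group G by (rule group_hom.axioms(1)[OF group_hom])
  have le: "mdist X (\<phi> (g [^] m) x) (\<phi> (g [^] k) x) = mdist X x (\<phi> (g [^] nat \<bar>m - k\<bar>) x)"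
    if "m \<le> k" for m k :: int
  proof -
    have "g [^] k = g [^] m \<otimes> g [^] nat \<bar>m - k\<bar>"
      using int_pow_mult[OF g, of m "k - m"] int_pow_int[of G g "nat \<bar>m - k\<bar>"] that by simp
    then have "\<phi> (g [^] k) x = \<phi> (g [^] m) (\<phi> (g [^] nat \<bar>m - k\<bar>) x)"
      using composition_rule[OF x] g by simp
    moreover have "\<phi> (g [^] m) \<in> isometries X"
      using act g by (simp add: isometric_action_def)
    ultimately show ?thesis
      using isometries_mdist x element_image[OF _ x] g by (metis nat_pow_closed)
  qed
  show ?thesis
    using le[of m k] le[of k m] by (cases "m \<le> k") (simp_all add: mdist_commute abs_minus_commute)
qed

lemma loxodromic_if_linear_displacement:
  fixes G (structure)
  assumes act: "isometric_action G X \<phi>" and g: "g \<in> carrier G" and x: "x \<in> mspace X"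
    and "c > 0" and lower: "\<And>n. c * real n - C \<le> mdist X x (\<phi> (g [^] n) x)"
    and upper: "\<And>n. mdist X x (\<phi> (g [^] n) x) \<le> real n * A"
  shows "loxodromic G X \<phi> g"
proof -
  interpret group_action G "mspace X" \<phi> using act by (simp add: isometric_action_def)
  interpret group G by (rule group_hom.axioms(1)[OF group_hom])
  \<comment> \<open>\<open>L \<ge> 1 / c\<close> serves the lower bound and \<open>L \<ge> A\<close>
    the upper one.\<close>
  define L where "L = max (max 1 (1 / c)) A"
  have L: "L \<ge> 1" "1 / c \<le> L" "A \<le> L" by (auto simp: L_def)
  have "1 / L \<le> c"
    using L \<open>c > 0\<close> by (simp add: field_simps)
  have *: "real n / L - max C 0 \<le> mdist X x (\<phi> (g [^] n) x)"
    "mdist X x (\<phi> (g [^] n) x) \<le> L * real n + max C 0" for n :: nat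
  proof -
    have "1 / L * n \<le> c * n" "n * A \<le> n * L"
      using \<open>1 / L \<le> c\<close> L by (auto intro!: mult_right_mono mult_left_mono simp del: times_divide_eq_left)
    then show "real n / L - max C 0 \<le> mdist X x (\<phi> (g [^] n) x)"
      "mdist X x (\<phi> (g [^] n) x) \<le> L * real n + max C 0"
      using lower[of n] upper[of n] by (auto simp: algebra_simps)
  qed
  have "mdist int_metric m k / L - max C 0 \<le> mdist X (\<phi> (g [^] m) x) (\<phi> (g [^] k) x) \<and>
      mdist X (\<phi> (g [^] m) x) (\<phi> (g [^] k) x) \<le> L * mdist int_metric m k + max C 0" for m k :: int
    using *[of "nat \<bar>m - k\<bar>"] isometric_action_mdist_int_pow[OF act g x, of m k] by auto
  moreover have "(\<lambda>k::int. \<phi> (g [^] k) x) \<in> mspace int_metric \<rightarrow> mspace X"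
    using element_image[OF _ x] g by auto
  moreover have "max C 0 \<ge> 0" by simp
  ultimately have "quasi_isometric_embedding int_metric X (\<lambda>k::int. \<phi> (g [^] k) x)"
    unfolding quasi_isometric_embedding_def using L(1) by blast
  then show ?thesis using x by (auto simp: loxodromic_def)
qed

lemma elliptic_if_bounded_displacement:
  fixes G (structure)
  assumes act: "isometric_action G X \<phi>" and g: "g \<in> carrier G"
    and bounded: "\<And>x. x \<in> mspace X \<Longrightarrow> \<exists>B. \<forall>n::nat. mdist X x (\<phi> (g [^] n) x) \<le> B"
  shows "elliptic G X \<phi> g"
  unfolding elliptic_def
proof
  fix x assume x: "x \<in> mspace X"
  interpret group_action G "mspace X" \<phi> using act by (simp add: isometric_action_def)
  interpret group G by (rule group_hom.axioms(1)[OF group_hom])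
  interpret M: Metric_space "mspace X" "mdist X" by (rule Metric_space_mspace_mdist)
  obtain B where B: "\<And>n::nat. mdist X x (\<phi> (g [^] n) x) \<le> B" using bounded[OF x] by blast
  have "\<phi> (g [^] (0::int)) x = x" using fun_cong[OF id_eq_one, of x] x by simp
  then have "mdist X x (\<phi> (g [^] k) x) \<le> B" for k :: int
    using isometric_action_mdist_int_pow[OF act g x, of 0 k] B[of "nat \<bar>0 - k\<bar>"] by simp
  moreover have "\<phi> (g [^] k) x \<in> mspace X" for k :: int
    using element_image[OF int_pow_closed[OF g] x] by blast
  ultimately have "{\<phi> h x |h. h \<in> generate G {g}} \<subseteq> M.mcball x B"
    using x g by (auto simp: generate_pow)
  then show "M.mbounded {\<phi> h x |h. h \<in> generate G {g}}"
    by (auto simp: M.mbounded_def)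
qed

theorem theorem4p3:
  fixes G :: "('g, 'm) monoid_scheme"
    and r :: nat
    and X :: "nat \<Rightarrow> 'a metric"
    and \<phi> :: "'g \<Rightarrow> (nat \<Rightarrow> 'a) \<Rightarrow> (nat \<Rightarrow> 'a)"
  assumes "group G"
    and "r \<ge> 1"
    and "\<forall>i\<in>{1..r}. hyperbolic_space (X i)"
    and "isometric_action G (l1_product r X) \<phi>"
    and "acylindrical G (l1_product r X) \<phi>"
    and "preserves_factors G r X \<phi>"
  shows "\<not> (\<exists>g\<in>carrier G. parabolic G (l1_product r X) \<phi> g)"
proof
  assume "\<exists>g\<in>carrier G. parabolic G (l1_product r X) \<phi> g"
  then obtain g where g: "g \<in> carrier G" and not_ell: "\<not> elliptic G (l1_product r X) \<phi> g"
    and not_lox: "\<not> loxodromic G (l1_product r X) \<phi> g"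
    by (auto simp: parabolic_def)
  let ?P = "l1_product r X"
  interpret group G by fact
  interpret group_action G "mspace ?P" \<phi>
    using assms(4) by (simp add: isometric_action_def)
  obtain h where h: "\<And>i. i \<in> {1..r} \<Longrightarrow> h i \<in> isometries (X i)"
    and \<phi>: "\<And>x. x \<in> mspace ?P \<Longrightarrow> \<phi> g x = (\<lambda>i\<in>{1..r}. h i (x i))"
    using assms(6) g unfolding preserves_factors_def by blast
  define a where "a i x n = mdist (X i) x ((h i ^^ n) x)" for i x n
  have pow: "\<phi> (g [^]\<^bsub>G\<^esub> n) x = (\<lambda>i\<in>{1..r}. (h i ^^ n) (x i))" if "x \<in> mspace ?P" for x and n :: nat
    by (rule action_nat_pow_l1_product[OF group_action_axioms g h \<phi> that])
  have disp: "mdist ?P x (\<phi> (g [^]\<^bsub>G\<^esub> n) x) = (\<Sum>i=1..r. a i (x i) n)" if "x \<in> mspace ?P" for x and n :: nat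
    using pow[OF that] by (simp add: a_def)
  obtain x where x: "x \<in> mspace ?P"
    and x_unbounded: "\<And>B. \<exists>n. (\<Sum>i=1..r. a i (x i) n) > B"
  proof -
    have "\<exists>x\<in>mspace ?P. \<forall>B. \<exists>n::nat. \<not> mdist ?P x (\<phi> (g [^]\<^bsub>G\<^esub> n) x) \<le> B"
      using elliptic_if_bounded_displacement[OF assms(4) g] not_ell by blast
    then show ?thesis using that by (metis disp not_le)
  qed
  have xi: "x i \<in> mspace (X i)" if "i \<in> {1..r}" for i using x that by auto
  have factor_not_lox: "\<exists>n. a i p n < c * real n - C" if i: "i \<in> {1..r}" and p: "p \<in> mspace (X i)" and c: "c > 0" for i p c C
  proof (rule ccontr)
    assume "\<not> ?thesis"
    then have low: "c * real n - C \<le> a i p n" for n by (simp add: not_less)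
    \<comment> \<open>Linear growth in one factor forces it in the product, whose distance dominates
      that of each factor; the upper bound is automatic.\<close>
    define y where "y = x(i := p)"
    have y: "y \<in> mspace ?P" using x p i by (auto simp: y_def PiE_iff extensional_def)
    have "loxodromic G ?P \<phi> g"
    proof (rule loxodromic_if_linear_displacement
        [where A = "\<Sum>j=1..r. mdist (X j) (y j) (h j (y j))", OF assms(4) g y c])
      fix n :: nat
      have "a i (y i) n \<le> (\<Sum>j=1..r. a j (y j) n)"
        using i by (intro member_le_sum) (auto simp: a_def)
      then show "c * real n - C \<le> mdist ?P y (\<phi> (g [^]\<^bsub>G\<^esub> n) y)"
        using low[of n] disp[OF y] by (simp add: y_def)
      have "a j (y j) n \<le> n * mdist (X j) (y j) (h j (y j))" if "j \<in> {1..r}" for j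
        unfolding a_def using y that by (intro mdist_funpow_le h) auto
      then show "mdist ?P y (\<phi> (g [^]\<^bsub>G\<^esub> n) y) \<le> real n * (\<Sum>j=1..r. mdist (X j) (y j) (h j (y j)))"
        unfolding disp[OF y] sum_distrib_left by (intro sum_mono)
    qed
    then show False using not_lox by simp
  qed
  have "\<exists>i\<in>{1..r}. \<forall>B. \<exists>n. a i (x i) n > B"
  proof (rule ccontr)
    assume "\<not> ?thesis"
    then have "\<forall>i\<in>{1..r}. \<exists>B. \<forall>n. a i (x i) n \<le> B" by (meson not_le)
    then obtain B where "\<forall>i\<in>{1..r}. \<forall>n. a i (x i) n \<le> B i" by metis
    then have "(\<Sum>i=1..r. a i (x i) n) \<le> (\<Sum>i=1..r. B i)" for n by (intro sum_mono) auto
    then show False using x_unbounded by (meson not_le)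
  qed
  then obtain j where j: "j \<in> {1..r}" and j_unbounded: "\<And>B. \<exists>n. a j (x j) n > B" by blast
  \<comment> \<open>The bound \<open>e\<close> precedes \<open>R\<close> and \<open>N\<close>.
    Distant points are needed only in factor \<open>j\<close>; where the orbit of \<open>x i\<close>
    is bounded, \<open>p = q = x i\<close> works.\<close>
  have factor: "\<exists>e. \<forall>R N. \<exists>p\<in>mspace (X i). \<exists>q\<in>mspace (X i). (i = j \<longrightarrow> mdist (X i) p q \<ge> R) \<and>
      (\<forall>k\<le>N. a i p k \<le> e \<and> a i q k \<le> e)" if i: "i \<in> {1..r}" for i
  proof (cases "\<exists>B. \<forall>n. a i (x i) n \<le> B")
    case True
    then have "i \<noteq> j" using j_unbounded by (meson not_le)
    then show ?thesis using True xi[OF i] by blast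
  next
    case False
    then have unb: "\<exists>n. mdist (X i) (x i) ((h i ^^ n) (x i)) > B" for B
      by (auto simp: a_def not_le)
    obtain \<delta> where \<delta>: "\<delta> \<ge> 0" "delta_hyperbolic \<delta> (X i)" and geo: "geodesic_space (X i)"
      using assms(3) i unfolding hyperbolic_space_def by blast
    have nl: "\<exists>n. mdist (X i) p ((h i ^^ n) p) < c * real n - C" if "p \<in> mspace (X i)" "c > 0" for p c C
      using factor_not_lox[OF i that] by (simp add: a_def)
    show ?thesis
    proof (intro exI[of _ "16 * \<delta>"] allI)
      fix R N
      obtain p q where "p \<in> mspace (X i)" "q \<in> mspace (X i)" "mdist (X i) p q \<ge> R"
        "\<And>k. k \<le> N \<Longrightarrow> mdist (X i) p ((h i ^^ k) p) \<le> 16 * \<delta>"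
        "\<And>k. k \<le> N \<Longrightarrow> mdist (X i) q ((h i ^^ k) q) \<le> 16 * \<delta>"
        using parabolic_isometry_small_displacement[OF geo \<delta>(2,1) h[OF i] xi[OF i] unb nl]
        by metis
      then show "\<exists>p\<in>mspace (X i). \<exists>q\<in>mspace (X i). (i = j \<longrightarrow> mdist (X i) p q \<ge> R) \<and>
          (\<forall>k\<le>N. a i p k \<le> 16 * \<delta> \<and> a i q k \<le> 16 * \<delta>)"
        unfolding a_def by blast
    qed
  qed
  then obtain e where e: "\<And>i R N. i \<in> {1..r} \<Longrightarrow> \<exists>p\<in>mspace (X i). \<exists>q\<in>mspace (X i).
      (i = j \<longrightarrow> mdist (X i) p q \<ge> R) \<and> (\<forall>k\<le>N. a i p k \<le> e i \<and> a i q k \<le> e i)"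
    by metis
  define \<epsilon> where "\<epsilon> = (\<Sum>i=1..r. e i)"
  have "e i \<ge> 0" if "i \<in> {1..r}" for i
    using e[OF that, of 0 0] mdist_nonneg unfolding a_def by (meson le_refl order_trans)
  then have "\<epsilon> \<ge> 0" unfolding \<epsilon>_def by (rule sum_nonneg)
  define F where "F p q = {g \<in> carrier G. mdist ?P p (\<phi> g p) \<le> \<epsilon> \<and> mdist ?P q (\<phi> g q) \<le> \<epsilon>}" for p q
  obtain N R where NR: "\<And>p q. p \<in> mspace ?P \<Longrightarrow> q \<in> mspace ?P \<Longrightarrow> mdist ?P p q \<ge> R \<Longrightarrow>
      finite (F p q) \<and> card (F p q) \<le> N"
    using assms(5) \<open>\<epsilon> \<ge> 0\<close> unfolding acylindrical_def F_def by meson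
  \<comment> \<open>Only now, with \<open>N\<close> and \<open>R\<close> supplied by acylindricity
    for \<open>\<epsilon>\<close>, are the points chosen.\<close>
  obtain p q where pq: "\<And>i. i \<in> {1..r} \<Longrightarrow> p i \<in> mspace (X i) \<and> q i \<in> mspace (X i) \<and>
      (i = j \<longrightarrow> mdist (X i) (p i) (q i) \<ge> R) \<and> (\<forall>k\<le>N. a i (p i) k \<le> e i \<and> a i (q i) k \<le> e i)"
    using e[of _ R N] by metis
  let ?p = "restrict p {1..r}" and ?q = "restrict q {1..r}"
  have p: "?p \<in> mspace ?P" and q: "?q \<in> mspace ?P" using pq by auto
  have "mdist (X j) (?p j) (?q j) \<le> mdist ?P ?p ?q"
    unfolding mdist_l1_product using j by (intro member_le_sum) auto
  then have "mdist ?P ?p ?q \<ge> R" using pq[OF j] j by simp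
  then have fin: "finite (F ?p ?q)" "card (F ?p ?q) \<le> N" using NR[OF p q] by auto
  \<comment> \<open>The exponents from 0 to \<open>N\<close> give one element more than
    acylindricity permits, once they are known to be distinct.\<close>
  have "(\<lambda>k::nat. g [^]\<^bsub>G\<^esub> k) ` {..N} \<subseteq> F ?p ?q"
  proof (rule image_subsetI)
    fix k assume "k \<in> {..N}"
    then have "(\<Sum>i=1..r. a i (?p i) k) \<le> \<epsilon>" "(\<Sum>i=1..r. a i (?q i) k) \<le> \<epsilon>"
      unfolding \<epsilon>_def using pq by (auto intro!: sum_mono)
    then show "g [^]\<^bsub>G\<^esub> k \<in> F ?p ?q"
      unfolding F_def using disp[OF p] disp[OF q] g by simp
  qed
  \<comment> \<open>If two powers agreed, \<open>x j\<close> would have a finite orbit in factor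
    \<open>j\<close>, against \<open>j_unbounded\<close>.\<close>
  moreover have "inj (\<lambda>k::nat. g [^]\<^bsub>G\<^esub> k)"
  proof (rule linorder_injI, rule notI)
    fix m n :: nat
    assume "m < n" and eq: "g [^]\<^bsub>G\<^esub> m = g [^]\<^bsub>G\<^esub> n"
    define k where "k = n - m"
    have "k > 0" using \<open>m < n\<close> by (simp add: k_def)
    have "g [^]\<^bsub>G\<^esub> k = \<one>\<^bsub>G\<^esub>" unfolding k_def using pow_eq_div2[OF g] eq by metis
    then have "\<phi> (g [^]\<^bsub>G\<^esub> k) x = x" using x by (simp flip: id_eq_one)
    then have "(h j ^^ k) (x j) = x j" using fun_cong[OF pow[OF x, of k], of j] j by simp
    then have "a j (x j) n = a j (x j) (n mod k)" for n
      by (simp add: a_def funpow_mod_eq)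
    moreover have "a j (x j) (n mod k) \<le> k * mdist (X j) (x j) (h j (x j))" for n
    proof -
      have "a j (x j) (n mod k) \<le> (n mod k) * mdist (X j) (x j) (h j (x j))"
        unfolding a_def by (rule mdist_funpow_le[OF h[OF j] xi[OF j]])
      also have "\<dots> \<le> k * mdist (X j) (x j) (h j (x j))"
        using \<open>k > 0\<close> by (intro mult_right_mono) auto
      finally show ?thesis .
    qed
    ultimately show False using j_unbounded by (metis not_le)
  qed
  then have "card ((\<lambda>k::nat. g [^]\<^bsub>G\<^esub> k) ` {..N}) = Suc N"
    by (subst card_image) (auto intro: inj_on_subset)
  ultimately have "Suc N \<le> card (F ?p ?q)" using card_mono[OF fin(1)] by metis
  then show False using fin(2) by simp
qed

end
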